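(* Let $D=(E,\Phi)$ be a binary delta-matroid and let $a,b\in E$ with $a\neq b$. Then $$q_{\Delta}(D,x)-q_{\Delta}(D'_{ab},x)=q_{\Delta}(\widetilde{D}_{ab},x)-q_{\Delta}(\widetilde{D'_{ab}},x),$$ where $D'_{ab}$ is the result of exchanging the ends of the handles $a$ and $b$ in $D$, $\widetilde{D}_{ab}$ is the result of the handle slide taking $a$ over $b$ in $D$, and $\widetilde{D'_{ab}}$ is the result of the handle slide taking $a$ over $b$ applied to $D'_{ab}$.
   Context: A set system is a pair $(E,\Phi)$ with $E$ a finite set and $\Phi\subseteq 2^E$ nonempty; elements of $\Phi$ are feasible sets. A delta-matroid is a set system such that for all $X,Y\in\Phi$ and every $x\in X\Delta Y$ there is $y\in X\Delta Y$ with $\{x,y\}\Delta X\in\Phi$ ($\Delta$ = symmetric difference). For $X\subseteq E$, the twist is $D*X=(E,\{F\Delta X: F\in\Phi\})$. For a symmetric matrix $A$ over $\mathbb{F}_2$ with rows and columns indexed by $E$ (diagonal entries arbitrary), $M_A=(E,\Phi)$ where $X\in\Phi$ iff the principal submatrix $A[X]$ is nondegenerate (the empty matrix counts as nondegenerate). A delta-matroid is binary if it is a twist $M_A*X$ of some such $M_A$. For a set system $D=(E,\Phi)$ and distinct $a,b\in E$: the handle slide taking $a$ over $b$ is $\widetilde{D}_{ab}=(E,\Phi\Delta\{X\sqcup\{a\}: X\sqcup\{b\}\in\Phi,\ X\subseteq E\setminus\{a,b\}\})$; exchanging the ends of handles $a$ and $b$ gives $D'_{ab}=(E,\Phi\Delta\{X\sqcup\{a,b\}: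 X\in\Phi,\ X\subseteq E\setminus\{a,b\}\})$ (both operations preserve binary delta-matroids). The distance from $D$ to $X\subseteq E$ is $d_D(X)=\min_{F\in\Phi}|F\Delta X|$, and the interlace polynomial is $q_{\Delta}(D,x)=\sum_{\phi\subseteq E}x^{d_D(\phi)}$. *)

theory Defs
  imports
    "HOL-Library.Z2"
    "HOL-Combinatorics.Permutations"
    "HOL-Computational_Algebra.Polynomial"
begin

type_synonym 'a set_system = "'a set \<times> 'a set set"

fun is_set_system :: "'a set_system \<Rightarrow> bool" where
  "is_set_system (E, \<Phi>) \<longleftrightarrow> finite E \<and> \<Phi> \<subseteq> Pow E \<and> \<Phi> \<noteq> {}"

fun delta_matroid :: "'a set_system \<Rightarrow> bool" where
  "delta_matroid (E, \<Phi>) \<longleftrightarrow>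
     is_set_system (E, \<Phi>) \<and>
     (\<forall>X\<in>\<Phi>. \<forall>Y\<in>\<Phi>. \<forall>x\<in>sym_diff X Y. \<exists>y\<in>sym_diff X Y. sym_diff {x, y} X \<in> \<Phi>)"

fun twist :: "'a set_system \<Rightarrow> 'a set \<Rightarrow> 'a set_system" where
  "twist (E, \<Phi>) X = (E, (\<lambda>F. sym_diff F X) ` \<Phi>)"

text \<open>
  Matrices with rows and columns indexed by a finite set \<open>E\<close> are functions of two
  arguments, of which only the values on \<open>E \<times> E\<close> matter. The determinant of the
  principal submatrix \<open>A[X]\<close> is given by the Leibniz formula; it is \<open>1\<close> for \<open>X = {}\<close>.
\<close>

definition principal_minor :: "('a \<Rightarrow> 'a \<Rightarrow> 'b::comm_ring_1) \<Rightarrow> 'a set \<Rightarrow> 'b" where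
  "principal_minor A X = (\<Sum>p | p permutes X. of_int (sign p) * (\<Prod>i\<in>X. A i (p i)))"

definition symmetric_on :: "'a set \<Rightarrow> ('a \<Rightarrow> 'a \<Rightarrow> 'b) \<Rightarrow> bool" where
  "symmetric_on E A \<longleftrightarrow> (\<forall>i\<in>E. \<forall>j\<in>E. A i j = A j i)"

definition matrix_set_system :: "'a set \<Rightarrow> ('a \<Rightarrow> 'a \<Rightarrow> bit) \<Rightarrow> 'a set_system" where
  "matrix_set_system E A = (E, {X. X \<subseteq> E \<and> principal_minor A X \<noteq> 0})"

definition binary_delta_matroid :: "'a set_system \<Rightarrow> bool" where
  "binary_delta_matroid D \<longleftrightarrow>
     delta_matroid D \<and>
     (\<exists>A X. symmetric_on (fst D) A \<and> X \<subseteq> fst D \<and> D = twist (matrix_set_system (fst D) A) X)"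

fun handle_slide :: "'a \<Rightarrow> 'a \<Rightarrow> 'a set_system \<Rightarrow> 'a set_system" where
  "handle_slide a b (E, \<Phi>) =
     (E, sym_diff \<Phi> {X \<union> {a} | X. X \<union> {b} \<in> \<Phi> \<and> X \<subseteq> E - {a, b}})"

fun exchange_ends :: "'a \<Rightarrow> 'a \<Rightarrow> 'a set_system \<Rightarrow> 'a set_system" where
  "exchange_ends a b (E, \<Phi>) =
     (E, sym_diff \<Phi> {X \<union> {a, b} | X. X \<in> \<Phi> \<and> X \<subseteq> E - {a, b}})"

fun set_system_dist :: "'a set_system \<Rightarrow> 'a set \<Rightarrow> nat" where
  "set_system_dist (E, \<Phi>) X = Min ((\<lambda>F. card (sym_diff F X)) ` \<Phi>)"

definition interlace_poly :: "'a set_system \<Rightarrow> int poly" where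
  "interlace_poly D = (\<Sum>X\<in>Pow (fst D). monom 1 (set_system_dist D X))"

end

theory Submission
  imports Defs "Jordan_Normal_Form.Determinant"
begin

text \<open>
  Fix \<open>Y \<subseteq> E - {a, b}\<close>. Call the fibre over \<open>Z \<subseteq> E - {a, b}\<close> the family of all
  \<open>S \<subseteq> {a, b}\<close> such that \<open>Z \<union> S\<close> is feasible, and let \<open>c\<close> be the distance from \<open>Y\<close> to the nearest
  \<open>Z\<close> with nonempty fibre. Principal pivoting, which rewrites the delta-matroid as a twist of
  \<open>M_B\<close> by any prescribed feasible set, shows that all nonempty fibres at distance \<open>c\<close> coincide
  with one family \<open>P\<close>, and that every fibre \<open>Q\<close> at distance \<open>c + 1\<close> is orthogonal to \<open>P\<close>: the
  number of \<open>S \<in> P\<close> with \<open>{a, b} - S \<in> Q\<close> is even. Hence the distance to \<open>Y \<union> S\<close> is \<open>c\<close> plus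
  the distance from \<open>P\<close> to \<open>S\<close>. Exchanging ends and sliding handles act on each fibre separately,
  preserve nonemptiness and the parity pairing, and so keep \<open>c\<close> and merely transform \<open>P\<close>. The
  identity thus reduces to the 15 nonempty set systems on \<open>{a, b}\<close>.
\<close>

section \<open>Nondegenerate principal submatrices and pivoting\<close>

text \<open>By default, sums and products of bits are rewritten to \<open>XOR\<close> and
  \<open>AND\<close>, which would hide them from the ring and finite-sum lemmas.\<close>

declare add_bit_eq_xor [simp del] mult_bit_eq_and [simp del]

definition nondegenerate :: "('a \<Rightarrow> 'a \<Rightarrow> 'b::field) \<Rightarrow> 'a set \<Rightarrow> bool" where
  "nondegenerate A X \<longleftrightarrow>
     (\<forall>v. (\<forall>i\<in>X. (\<Sum>j\<in>X. A i j * v j) = 0) \<longrightarrow> (\<forall>i\<in>X. v i = 0))"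

text \<open>Conjugation along the enumeration \<open>h\<close> is a sign-preserving bijection from
  the permutations of \<open>{0..<n}\<close> to those of \<open>X\<close>, and it matches the
  Leibniz terms one by one.\<close>

lemma principal_minor_eq_det:
  fixes A :: "'a \<Rightarrow> 'a \<Rightarrow> 'b::comm_ring_1"
  assumes h: "bij_betw h {0..<n} X"
  shows "principal_minor A X = det (mat n n (\<lambda>(i, j). A (h i) (h j)))"
proof -
  let ?M = "mat n n (\<lambda>(i, j). A (h i) (h j))"
  let ?f = "\<lambda>p x. if x \<in> X then h (p (inv_into {0..<n} h x)) else x"
  have inj: "inj_on h {0..<n}" and img: "h ` {0..<n} = X"
    using h by (auto simp: bij_betw_def)
  have f_eq: "?f p = map_permutation {0..<n} h p" for p
    unfolding map_permutation_def img by (auto simp: restrict_id_def fun_eq_iff)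
  have term_eq: "of_int (sign (?f p)) * (\<Prod>i\<in>X. A i (?f p i)) =
      of_int (sign p) * (\<Prod>i = 0..<n. ?M $$ (i, p i))"
    if p: "p permutes {0..<n}" for p
  proof -
    have "(\<Prod>i\<in>X. A i (?f p i)) = (\<Prod>i = 0..<n. A (h i) (?f p (h i)))"
      by (rule prod.reindex_bij_betw[OF h, symmetric])
    also have "\<dots> = (\<Prod>i = 0..<n. ?M $$ (i, p i))"
    proof (rule prod.cong[OF refl])
      fix i assume i: "i \<in> {0..<n}"
      have "h i \<in> X" using i img by auto
      moreover have "p i \<in> {0..<n}" using permutes_in_image[OF p] i by blast
      ultimately show "A (h i) (?f p (h i)) = ?M $$ (i, p i)"
        using i by (simp add: inv_into_f_f[OF inj])
    qed
    finally show ?thesis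
      using sign_map_permutation[OF inj p] by (simp only: f_eq finite_atLeastLessThan)
  qed
  have "principal_minor A X =
      (\<Sum>p | p permutes {0..<n}. of_int (sign (?f p)) * (\<Prod>i\<in>X. A i (?f p i)))"
    unfolding principal_minor_def
    by (rule sum.reindex_bij_betw[OF bij_betw_permutations[OF h], symmetric])
  also have "\<dots> = det ?M"
    unfolding det_def'[OF mat_carrier] by (rule sum.cong) (use term_eq in auto)
  finally show ?thesis .
qed

lemma principal_minor_nonzero_iff_nondegenerate:
  assumes "finite X"
  shows "principal_minor A X \<noteq> 0 \<longleftrightarrow> nondegenerate A X"
proof -
  obtain h where h: "bij_betw h {0..<card X} X"
    using ex_bij_betw_nat_finite[OF assms] by blast
  let ?n = "card X"
  let ?M = "mat ?n ?n (\<lambda>(i, j). A (h i) (h j))"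
  have inj: "inj_on h {0..<?n}" and img: "h ` {0..<?n} = X"
    using h by (auto simp: bij_betw_def)
  have mult: "(?M *\<^sub>v vec ?n (\<lambda>i. v (h i))) $ i = (\<Sum>j\<in>X. A (h i) j * v j)"
    if "i < ?n" for v i
  proof -
    have "(?M *\<^sub>v vec ?n (\<lambda>i. v (h i))) $ i = (\<Sum>j = 0..<?n. A (h i) (h j) * v (h j))"
      using that by (simp add: scalar_prod_def)
    also have "\<dots> = (\<Sum>j\<in>X. A (h i) j * v j)"
      by (rule sum.reindex_bij_betw[OF h, of "\<lambda>j. A (h i) j * v j"])
    finally show ?thesis .
  qed
  have "(\<exists>w. w \<in> carrier_vec ?n \<and> w \<noteq> 0\<^sub>v ?n \<and> ?M *\<^sub>v w = 0\<^sub>v ?n) \<longleftrightarrow>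
      (\<exists>v. (\<forall>i\<in>X. (\<Sum>j\<in>X. A i j * v j) = 0) \<and> (\<exists>i\<in>X. v i \<noteq> 0))" (is "?L \<longleftrightarrow> ?R")
  proof
    assume ?L
    then obtain w where w: "w \<in> carrier_vec ?n" "w \<noteq> 0\<^sub>v ?n" "?M *\<^sub>v w = 0\<^sub>v ?n" by blast
    define v where "v x = w $ (inv_into {0..<?n} h x)" for x
    have vh: "v (h i) = w $ i" if "i < ?n" for i
      using that by (simp add: v_def inv_into_f_f[OF inj])
    have w_eq: "w = vec ?n (\<lambda>i. v (h i))" using w(1) vh by auto
    have "(\<Sum>j\<in>X. A i j * v j) = 0" if i: "i \<in> X" for i
    proof -
      have "i \<in> h ` {0..<?n}" using i img by simp
      then obtain k where "k < ?n" "i = h k" by auto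
      moreover have "(?M *\<^sub>v w) $ k = 0" using \<open>k < ?n\<close> w(3) by simp
      ultimately show ?thesis using mult[of k v] w_eq by metis
    qed
    moreover have "\<exists>i\<in>X. v i \<noteq> 0"
    proof (rule ccontr)
      assume "\<not> ?thesis"
      then have "w $ i = 0" if "i < ?n" for i using that vh[of i] img by force
      then show False using w(1,2) by auto
    qed
    ultimately show ?R by blast
  next
    assume ?R
    then obtain v where v: "\<forall>i\<in>X. (\<Sum>j\<in>X. A i j * v j) = 0" "\<exists>i\<in>X. v i \<noteq> 0" by blast
    let ?w = "vec ?n (\<lambda>i. v (h i))"
    have "\<exists>i\<in>h ` {0..<?n}. v i \<noteq> 0" using v(2) img by simp
    then obtain k where k: "k < ?n" "v (h k) \<noteq> 0" by auto
    then have "?w $ k \<noteq> 0" by simp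
    then have "?w \<noteq> 0\<^sub>v ?n" using k(1) by (metis index_zero_vec(1))
    moreover have "?M *\<^sub>v ?w = 0\<^sub>v ?n"
    proof (rule eq_vecI)
      fix i assume "i < dim_vec (0\<^sub>v ?n :: 'b vec)"
      then have i: "i < ?n" by simp
      then have "h i \<in> X" using img by auto
      then have "(?M *\<^sub>v ?w) $ i = 0" using mult[OF i, of v] v(1) by metis
      then show "(?M *\<^sub>v ?w) $ i = 0\<^sub>v ?n $ i" using i by simp
    qed simp
    ultimately show ?L by (intro exI[of _ ?w]) simp
  qed
  then show ?thesis
    unfolding principal_minor_eq_det[OF h] nondegenerate_def
      det_0_iff_vec_prod_zero_field[OF mat_carrier]
    by blast
qed

text \<open>Kernel vectors are extended by zero, so that every sum runs over \<open>E\<close> and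
  \<open>X\<close> enters only through two conditions: \<open>v\<close> vanishes off
  \<open>X\<close>, and the product of \<open>A\<close> and \<open>v\<close> vanishes on
  \<open>X\<close>. Pivoting swaps these two kinds of condition at single indices.\<close>

lemma nondegenerate_iff_ambient:
  assumes "finite E" "X \<subseteq> E"
  shows "nondegenerate A X \<longleftrightarrow>
    (\<forall>v. (\<forall>i\<in>E - X. v i = 0) \<longrightarrow> (\<forall>i\<in>X. (\<Sum>j\<in>E. A i j * v j) = 0) \<longrightarrow> (\<forall>i\<in>E. v i = 0))"
    (is "_ \<longleftrightarrow> ?R")
proof -
  have sum_eq: "(\<Sum>j\<in>E. A i j * v j) = (\<Sum>j\<in>X. A i j * v j)"
    if "\<forall>i\<in>E - X. v i = 0" for v i
    by (rule sum.mono_neutral_right) (use assms that in auto)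
  show ?thesis
  proof
    assume nd: "nondegenerate A X"
    show ?R
    proof (intro allI impI)
      fix v assume v: "\<forall>i\<in>E - X. v i = 0" "\<forall>i\<in>X. (\<Sum>j\<in>E. A i j * v j) = 0"
      then have "\<forall>i\<in>X. v i = 0" using nd sum_eq[OF v(1)] by (simp add: nondegenerate_def)
      then show "\<forall>i\<in>E. v i = 0" using v(1) by blast
    qed
  next
    assume R: ?R
    show "nondegenerate A X"
      unfolding nondegenerate_def
    proof (intro allI impI)
      fix v assume v: "\<forall>i\<in>X. (\<Sum>j\<in>X. A i j * v j) = 0"
      let ?w = "\<lambda>i. if i \<in> X then v i else 0"
      have "(\<Sum>j\<in>X. A i j * ?w j) = (\<Sum>j\<in>X. A i j * v j)" for i
        by (rule sum.cong) auto
      then have "\<forall>i\<in>X. (\<Sum>j\<in>E. A i j * ?w j) = 0" using v sum_eq[of ?w] by simp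
      then have "\<forall>i\<in>E. ?w i = 0" using R[rule_format, of ?w] by auto
      then show "\<forall>i\<in>X. v i = 0" using assms(2) by (metis subsetD)
    qed
  qed
qed

lemma bit_add_self: "x + x = (0::bit)"
  by (cases x) auto

lemma finite_UNIV_bit: "finite (UNIV :: bit set)"
proof -
  have "(UNIV :: bit set) = {0, 1}" using bit_not_zero_iff by auto
  then show ?thesis by (metis finite.emptyI finite.insertI)
qed

text \<open>
  The vectors \<open>(v, A v)\<close> form a Lagrangian subspace. Swapping the two coordinates at the indices in
  \<open>G\<close> turns it into the graph of another symmetric matrix \<open>B\<close>; \<open>\<phi>\<close> and \<open>\<psi>\<close> below are the two
  halves of a vector after the swap, and nondegeneracy of \<open>A[G]\<close> makes \<open>\<phi>\<close> bijective.
\<close>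

lemma principal_pivot:
  fixes A :: "'a \<Rightarrow> 'a \<Rightarrow> bit"
  assumes fin: "finite E" and sym: "symmetric_on E A" and G: "G \<subseteq> E" and nd: "nondegenerate A G"
  shows "\<exists>B :: 'a \<Rightarrow> 'a \<Rightarrow> bit. symmetric_on E B \<and>
    (\<forall>T\<subseteq>E. nondegenerate A (sym_diff G T) \<longleftrightarrow> nondegenerate B T)"
proof -
  define V where "V = {v :: 'a \<Rightarrow> bit. \<forall>i. i \<notin> E \<longrightarrow> v i = 0}"
  define m where "m v i = (\<Sum>j\<in>E. A i j * v j)" for v :: "'a \<Rightarrow> bit" and i
  define \<phi> where "\<phi> v i = (if i \<in> E then if i \<in> G then m v i else v i else 0)" for v i
  define \<psi> where "\<psi> v i = (if i \<in> E then if i \<in> G then v i else m v i else 0)" for v i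
  have finV: "finite V"
  proof -
    have "V = {v. \<forall>x. (x \<in> E \<longrightarrow> v x \<in> UNIV) \<and> (x \<notin> E \<longrightarrow> v x = 0)}" by (auto simp: V_def)
    then show ?thesis using finite_set_of_finite_funs[OF fin finite_UNIV_bit] by simp
  qed
  have m_add: "m (\<lambda>i. u i + v i) i = m u i + m v i" for u v i
    by (simp add: m_def distrib_left sum.distrib)
  have ker: "v = (\<lambda>_. 0)" if v: "v \<in> V" "\<phi> v = (\<lambda>_. 0)" for v
  proof -
    have "\<phi> v i = 0" for i using v(2) by simp
    then have "\<forall>i\<in>E - G. v i = 0" "\<forall>i\<in>G. m v i = 0"
      using G unfolding \<phi>_def by (metis Diff_iff, metis subsetD)
    then have "\<forall>i\<in>E. v i = 0"
      using nd unfolding nondegenerate_iff_ambient[OF fin G] m_def by blast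
    then show ?thesis using v(1) by (auto simp: V_def)
  qed
  have "inj_on \<phi> V"
  proof (rule inj_onI)
    fix u v assume uv: "u \<in> V" "v \<in> V" "\<phi> u = \<phi> v"
    let ?w = "\<lambda>i. u i + v i"
    have "\<phi> ?w i = \<phi> u i + \<phi> v i" for i by (simp add: \<phi>_def m_add)
    then have "\<phi> ?w = (\<lambda>_. 0)" using uv(3) by (auto simp: bit_add_self)
    moreover have "?w \<in> V" using uv by (simp add: V_def)
    ultimately have "?w = (\<lambda>_. 0)" using ker by blast
    then have "u i + v i = 0" for i by meson
    then have "u i = v i" for i
      by (metis add.assoc add.right_neutral bit_add_self)
    then show "u = v" by blast
  qed
  moreover have "\<phi> ` V \<subseteq> V" by (auto simp: V_def \<phi>_def)
  \<comment> \<open>Finiteness of \<open>V\<close>, which rests on that of \<open>bit\<close>, takes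
    the place of a dimension count.\<close>
  ultimately have surj: "\<phi> ` V = V" using endo_inj_surj[OF finV] by blast
  have "\<exists>u\<in>V. \<phi> u = (\<lambda>i. if i = j then 1 else 0)" if "j \<in> E" for j
  proof -
    have "(\<lambda>i. if i = j then 1 else 0) \<in> V" using that by (auto simp: V_def)
    then show ?thesis using surj by (metis imageE)
  qed
  then obtain u where u: "\<And>j. j \<in> E \<Longrightarrow> u j \<in> V"
    "\<And>j. j \<in> E \<Longrightarrow> \<phi> (u j) = (\<lambda>i. if i = j then 1 else 0)" by metis
  \<comment> \<open>Column \<open>j\<close> of \<open>B\<close> is the \<open>\<psi>\<close>-half of
    the vector whose \<open>\<phi>\<close>-half is the unit vector at \<open>j\<close>, so that
    \<open>B\<close> represents the map from \<open>\<phi> v\<close> to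
    \<open>\<psi> v\<close>.\<close>
  define B where "B i j = \<psi> (u j) i" for i j
  \<comment> \<open>At each index, \<open>\<phi> x i * \<psi> y i + \<psi> x i * \<phi> y i\<close>
    is unaffected by the swap, as signs are invisible modulo 2. The claim thus reduces to symmetry
    of the bilinear form of \<open>A\<close>.\<close>
  have isotropic: "(\<Sum>i\<in>E. \<phi> x i * \<psi> y i) = (\<Sum>i\<in>E. \<psi> x i * \<phi> y i)" for x y
  proof -
    have "(\<Sum>i\<in>E. \<phi> x i * \<psi> y i) + (\<Sum>i\<in>E. \<psi> x i * \<phi> y i) =
        (\<Sum>i\<in>E. m x i * y i) + (\<Sum>i\<in>E. x i * m y i)"
      unfolding sum.distrib[symmetric]
      by (rule sum.cong) (auto simp: \<phi>_def \<psi>_def add.commute)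
    moreover have "(\<Sum>i\<in>E. m x i * y i) = (\<Sum>i\<in>E. x i * m y i)"
    proof -
      have "(\<Sum>i\<in>E. m x i * y i) = (\<Sum>i\<in>E. \<Sum>j\<in>E. A i j * x j * y i)"
        by (simp add: m_def sum_distrib_right)
      also have "\<dots> = (\<Sum>j\<in>E. \<Sum>i\<in>E. A i j * x j * y i)" by (rule sum.swap)
      also have "\<dots> = (\<Sum>j\<in>E. x j * m y j)"
        unfolding m_def sum_distrib_left
        by (intro sum.cong refl) (use sym in \<open>simp add: symmetric_on_def mult_ac\<close>)
      finally show ?thesis .
    qed
    ultimately have "(\<Sum>i\<in>E. \<phi> x i * \<psi> y i) + (\<Sum>i\<in>E. \<psi> x i * \<phi> y i) = 0"
      by (simp add: bit_add_self)
    then show ?thesis by (metis add.assoc add.right_neutral bit_add_self)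
  qed
  have symB: "symmetric_on E B"
    unfolding symmetric_on_def
  proof (intro ballI)
    fix i j assume ij: "i \<in> E" "j \<in> E"
    have "(\<Sum>k\<in>E. \<phi> (u i) k * \<psi> (u j) k) = B i j"
      using ij fin by (simp add: u(2) B_def if_distrib[of "\<lambda>x. x * _"] cong: if_cong)
    moreover have "(\<Sum>k\<in>E. \<psi> (u i) k * \<phi> (u j) k) = B j i"
      using ij fin by (simp add: u(2) B_def if_distrib[of "\<lambda>x. _ * x"] cong: if_cong)
    ultimately show "B i j = B j i" using isotropic by metis
  qed
  have pivB: "nondegenerate A (sym_diff G T) \<longleftrightarrow> nondegenerate B T" if T: "T \<subseteq> E" for T
  proof -
    let ?X = "sym_diff G T"
    have X: "?X \<subseteq> E" using G T by blast
    \<comment> \<open>Membership in \<open>G\<close> exchanges the roles of \<open>v\<close> and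
      \<open>m v\<close>, which turns the index set \<open>sym_diff G T\<close> into
      \<open>T\<close>.\<close>
    have cond: "(\<forall>i\<in>E - ?X. v i = 0) \<and> (\<forall>i\<in>?X. m v i = 0) \<longleftrightarrow>
        (\<forall>i\<in>E - T. \<phi> v i = 0) \<and> (\<forall>i\<in>T. \<psi> v i = 0)" for v
      using G T unfolding \<phi>_def \<psi>_def by (auto split: if_splits)
    \<comment> \<open>Row \<open>i\<close> of \<open>B\<close> is its column \<open>i\<close> by
      symmetry; isotropy against \<open>u i\<close> then extracts the entry of
      \<open>\<psi> v\<close> at \<open>i\<close>.\<close>
    have \<psi>_eq: "\<psi> v i = (\<Sum>j\<in>E. B i j * \<phi> v j)" if v: "v \<in> V" and i: "i \<in> E" for v i
    proof -
      have "(\<Sum>j\<in>E. B i j * \<phi> v j) = (\<Sum>j\<in>E. B j i * \<phi> v j)"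
        using symB i by (intro sum.cong) (auto simp: symmetric_on_def)
      also have "\<dots> = (\<Sum>j\<in>E. \<psi> (u i) j * \<phi> v j)" by (simp add: B_def)
      also have "\<dots> = (\<Sum>j\<in>E. \<phi> (u i) j * \<psi> v j)" using isotropic by metis
      also have "\<dots> = \<psi> v i"
        using i fin by (simp add: u(2) if_distrib[of "\<lambda>x. x * _"] cong: if_cong)
      finally show ?thesis by simp
    qed
    have "nondegenerate A ?X \<longleftrightarrow>
        (\<forall>v\<in>V. (\<forall>i\<in>E - T. \<phi> v i = 0) \<and> (\<forall>i\<in>T. \<psi> v i = 0) \<longrightarrow> (\<forall>i\<in>E. \<phi> v i = 0))"
      (is "_ \<longleftrightarrow> ?C")
    proof
      assume nX: "nondegenerate A ?X"
      show ?C
      proof (intro ballI impI)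
        fix v i assume v: "v \<in> V" "(\<forall>i\<in>E - T. \<phi> v i = 0) \<and> (\<forall>i\<in>T. \<psi> v i = 0)" and "i \<in> E"
        then have "\<forall>i\<in>E - ?X. v i = 0" "\<forall>i\<in>?X. m v i = 0" using cond[of v] by simp_all
        then have "\<forall>i\<in>E. v i = 0"
          using nX unfolding nondegenerate_iff_ambient[OF fin X] m_def by simp
        then show "\<phi> v i = 0" by (simp add: \<phi>_def m_def)
      qed
    next
      assume C: ?C
      show "nondegenerate A ?X"
        unfolding nondegenerate_iff_ambient[OF fin X]
      proof (intro allI impI)
        fix v assume v: "\<forall>i\<in>E - ?X. v i = 0" "\<forall>i\<in>?X. (\<Sum>j\<in>E. A i j * v j) = 0"
        let ?w = "\<lambda>i. if i \<in> E then v i else 0"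
        have w: "?w \<in> V" by (auto simp: V_def)
        have "m ?w i = (\<Sum>j\<in>E. A i j * v j)" for i unfolding m_def by (rule sum.cong) auto
        then have "(\<forall>i\<in>E - ?X. ?w i = 0) \<and> (\<forall>i\<in>?X. m ?w i = 0)" using v by auto
        then have "(\<forall>i\<in>E - T. \<phi> ?w i = 0) \<and> (\<forall>i\<in>T. \<psi> ?w i = 0)"
          by (rule cond[THEN iffD1])
        then have "\<forall>i\<in>E. \<phi> ?w i = 0" by (rule C[THEN bspec, OF w, THEN mp])
        then have "\<phi> ?w = (\<lambda>_. 0)" by (auto simp: \<phi>_def)
        then have "?w = (\<lambda>_. 0)" using ker w by blast
        then show "\<forall>i\<in>E. v i = 0" by metis
      qed
    qed
    also have "\<dots> \<longleftrightarrow> (\<forall>c\<in>V. (\<forall>i\<in>E - T. c i = 0) \<and> (\<forall>i\<in>T. (\<Sum>j\<in>E. B i j * c j) = 0)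
        \<longrightarrow> (\<forall>i\<in>E. c i = 0))" (is "_ \<longleftrightarrow> ?D")
    proof -
      have "?D \<longleftrightarrow> (\<forall>c\<in>\<phi> ` V. (\<forall>i\<in>E - T. c i = 0) \<and> (\<forall>i\<in>T. (\<Sum>j\<in>E. B i j * c j) = 0)
        \<longrightarrow> (\<forall>i\<in>E. c i = 0))" using surj by simp
      also have "\<dots> \<longleftrightarrow> ?C" using \<psi>_eq T by (auto simp: subset_iff)
      finally show ?thesis by blast
    qed
    also have "\<dots> \<longleftrightarrow> nondegenerate B T"
      unfolding nondegenerate_iff_ambient[OF fin T]
    proof (intro iffI allI impI)
      fix v assume D: ?D and v: "\<forall>i\<in>E - T. v i = 0" "\<forall>i\<in>T. (\<Sum>j\<in>E. B i j * v j) = 0"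
      let ?w = "\<lambda>i. if i \<in> E then v i else 0"
      have "?w \<in> V" by (auto simp: V_def)
      moreover have "(\<Sum>j\<in>E. B i j * ?w j) = (\<Sum>j\<in>E. B i j * v j)" for i
        by (rule sum.cong) auto
      ultimately have "\<forall>i\<in>E. ?w i = 0" using D[rule_format, of ?w] v by auto
      then show "\<forall>i\<in>E. v i = 0" by metis
    qed blast
    finally show ?thesis .
  qed
  show ?thesis using symB pivB by (intro exI[of _ B]) simp
qed

lemma nondegenerate_column_nonzero:
  assumes "nondegenerate B X" "finite X" "x \<in> X"
  shows "\<exists>i\<in>X. B i x \<noteq> 0"
proof (rule ccontr)
  assume "\<not> ?thesis"
  then have "\<forall>i\<in>X. (\<Sum>j\<in>X. B i j * (if j = x then 1 else 0)) = 0"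
    using assms(2,3) by (simp add: if_distrib[of "\<lambda>z. _ * z"] cong: if_cong)
  then have "\<forall>i\<in>X. (if i = x then 1 else 0) = (0::'b)"
    using assms(1) unfolding nondegenerate_def by (elim allE) (erule mp)
  then show False using assms(3) by auto
qed

text \<open>Row \<open>x\<close> has only its entry at \<open>y\<close>, so it forces
  \<open>v y = 0\<close>. Column \<open>x\<close> vanishes on \<open>T\<close>, so the rows in
  \<open>T\<close> then see only \<open>T\<close>, and row \<open>y\<close> merely determines
  \<open>v x\<close>.\<close>

lemma nondegenerate_hyperbolic_pair:
  assumes fin: "finite T" and xy: "x \<notin> T" "y \<notin> T" "x \<noteq> y"
    and B: "B x x = 0" "\<And>t. t \<in> T \<Longrightarrow> B x t = 0" "\<And>t. t \<in> T \<Longrightarrow> B t x = 0" "B x y \<noteq> 0" "B y x \<noteq> 0"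
  shows "nondegenerate B (insert x (insert y T)) \<longleftrightarrow> nondegenerate B T"
proof -
  let ?X = "insert x (insert y T)"
  have row: "(\<Sum>j\<in>?X. B i j * v j) = B i x * v x + (B i y * v y + (\<Sum>j\<in>T. B i j * v j))" for i v
    using fin xy by simp
  have row_x: "(\<Sum>j\<in>T. B x j * v j) = 0" for v by (rule sum.neutral) (use B in auto)
  show ?thesis
  proof
    assume nd: "nondegenerate B ?X"
    show "nondegenerate B T"
      unfolding nondegenerate_def
    proof (intro allI impI)
      fix v assume v: "\<forall>i\<in>T. (\<Sum>j\<in>T. B i j * v j) = 0"
      \<comment> \<open>The value at \<open>x\<close> solves row \<open>y\<close>; the value 0 at
        \<open>y\<close> keeps the other rows valid.\<close>
      define w where "w = v(x := - (\<Sum>j\<in>T. B y j * v j) / B y x, y := 0)"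
      have w: "(\<Sum>j\<in>T. B i j * w j) = (\<Sum>j\<in>T. B i j * v j)" for i
        by (rule sum.cong) (use xy in \<open>auto simp: w_def\<close>)
      have "(\<Sum>j\<in>?X. B i j * w j) = 0" if "i \<in> ?X" for i
        unfolding row w using that v B xy row_x[of v] by (auto simp: w_def)
      then have "\<forall>i\<in>?X. w i = 0" using nd unfolding nondegenerate_def by blast
      moreover have "w i = v i" if "i \<in> T" for i using xy that by (auto simp: w_def)
      ultimately show "\<forall>i\<in>T. v i = 0" by (metis insertCI)
    qed
  next
    assume nd: "nondegenerate B T"
    show "nondegenerate B ?X"
      unfolding nondegenerate_def
    proof (intro allI impI)
      fix v assume v: "\<forall>i\<in>?X. (\<Sum>j\<in>?X. B i j * v j) = 0"
      have vy: "v y = 0" using v[rule_format, of x] B(1,4) row_x[of v] unfolding row by simp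
      have "\<forall>i\<in>T. (\<Sum>j\<in>T. B i j * v j) = 0" using v vy B(3) unfolding row by simp
      then have vT: "\<forall>i\<in>T. v i = 0" using nd unfolding nondegenerate_def by blast
      then have "(\<Sum>j\<in>T. B y j * v j) = 0" by (intro sum.neutral) simp
      then have "v x = 0" using v[rule_format, of y] vy B(5) unfolding row by simp
      then show "\<forall>i\<in>?X. v i = 0" using vy vT by blast
    qed
  qed
qed

section \<open>Nondegeneracy over the two-element field for at most three indices\<close>

lemma all_bit_iff: "(\<forall>x::bit. P x) \<longleftrightarrow> P 0 \<and> P 1"
  by (metis bit_not_zero_iff)

lemma nondegenerate_empty: "nondegenerate B {}"
  by (simp add: nondegenerate_def)

lemma nondegenerate_singleton: "nondegenerate B {x} \<longleftrightarrow> B x x = (1::bit)"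
proof -
  have "nondegenerate B {x} \<longleftrightarrow> (\<forall>u. B x x * u = 0 \<longrightarrow> u = 0)"
    unfolding nondegenerate_def by (auto dest: spec[of _ "\<lambda>_. _"])
  then show ?thesis by (cases "B x x") (simp_all add: all_bit_iff)
qed

lemma nondegenerate_doubleton:
  assumes "x \<noteq> y"
  shows "nondegenerate B {x, y} \<longleftrightarrow> B x x * B y y + B x y * B y x = (1::bit)"
proof -
  have "nondegenerate B {x, y} \<longleftrightarrow>
      (\<forall>u w. B x x * u + B x y * w = 0 \<and> B y x * u + B y y * w = 0 \<longrightarrow> u = 0 \<and> w = 0)"
  proof -
    have "nondegenerate B {x, y} \<longleftrightarrow> (\<forall>v. B x x * v x + B x y * v y = 0 \<and>
        B y x * v x + B y y * v y = 0 \<longrightarrow> v x = 0 \<and> v y = 0)" (is "_ \<longleftrightarrow> (\<forall>v. ?P (v x) (v y))")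
      using assms by (simp add: nondegenerate_def)
    also have "\<dots> \<longleftrightarrow> (\<forall>u w. ?P u w)"
    proof (intro iffI allI)
      fix u w assume "\<forall>v. ?P (v x) (v y)"
      then show "?P u w" using assms by (elim allE[of _ "\<lambda>k. if k = x then u else w"]) simp
    qed blast
    finally show ?thesis .
  qed
  then show ?thesis
    by (cases "B x x"; cases "B x y"; cases "B y x"; cases "B y y") (simp_all add: all_bit_iff)
qed

text \<open>Modulo 2 the two cyclic Leibniz terms of a symmetric matrix cancel and
  \<open>B x y * B x y\<close> equals \<open>B x y\<close>, which gives this form of the
  determinant.\<close>

lemma nondegenerate_tripleton:
  assumes d: "x \<noteq> y" "x \<noteq> z" "y \<noteq> z" and sym: "B y x = B x y" "B z x = B x z" "B z y = B y z"
  shows "nondegenerate B {x, y, z} \<longleftrightarrow>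
    B x x * B y y * B z z + B x x * B y z + B y y * B x z + B z z * B x y = (1::bit)"
proof -
  have "nondegenerate B {x, y, z} \<longleftrightarrow>
      (\<forall>u v w. B x x * u + (B x y * v + B x z * w) = 0 \<and> B x y * u + (B y y * v + B y z * w) = 0 \<and>
        B x z * u + (B y z * v + B z z * w) = 0 \<longrightarrow> u = 0 \<and> v = 0 \<and> w = 0)"
      (is "_ \<longleftrightarrow> (\<forall>u v w. ?P u v w)")
  proof -
    have "nondegenerate B {x, y, z} \<longleftrightarrow> (\<forall>v. ?P (v x) (v y) (v z))"
      using d sym by (simp add: nondegenerate_def)
    also have "\<dots> \<longleftrightarrow> (\<forall>u v w. ?P u v w)"
    proof (intro iffI allI)
      fix u v w assume "\<forall>v. ?P (v x) (v y) (v z)"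
      then show "?P u v w"
        using d by (elim allE[of _ "\<lambda>k. if k = x then u else if k = y then v else w"]) simp
    qed blast
    finally show ?thesis .
  qed
  then show ?thesis
    by (cases "B x x"; cases "B y y"; cases "B z z"; cases "B x y"; cases "B x z"; cases "B y z")
      (simp_all add: all_bit_iff)
qed

section \<open>Fibres over subsets avoiding two elements\<close>

text \<open>Subsets of \<open>{a, b}\<close> are encoded by the membership bits of \<open>a\<close> and \<open>b\<close>.\<close>

definition corner :: "'a \<Rightarrow> 'a \<Rightarrow> bool \<Rightarrow> bool \<Rightarrow> 'a set" where
  "corner a b s t = {x. x = a \<and> s \<or> x = b \<and> t}"

definition fibre :: "'a \<Rightarrow> 'a \<Rightarrow> 'a set set \<Rightarrow> 'a set \<Rightarrow> bool \<Rightarrow> bool \<Rightarrow> bool" where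
  "fibre a b \<Phi> Z s t \<longleftrightarrow> Z \<union> corner a b s t \<in> \<Phi>"

text \<open>The parity of the number of \<open>S \<in> P\<close> whose complement in \<open>{a, b}\<close> lies in \<open>Q\<close>.\<close>

definition odd_pairing :: "(bool \<Rightarrow> bool \<Rightarrow> bool) \<Rightarrow> (bool \<Rightarrow> bool \<Rightarrow> bool) \<Rightarrow> bool" where
  "odd_pairing P Q \<longleftrightarrow>
     (((P False False \<and> Q True True) \<noteq> (P True True \<and> Q False False)) \<noteq>
      ((P False True \<and> Q True False) \<noteq> (P True False \<and> Q False True)))"

text \<open>The form in which binarity is used below: seen from any feasible \<open>F\<close>, the
  system is some \<open>M_B\<close>, with \<open>B\<close> depending on \<open>F\<close>.\<close>

definition pivotable :: "'a set \<Rightarrow> 'a set set \<Rightarrow> bool" where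
  "pivotable E \<Phi> \<longleftrightarrow> (\<forall>F\<in>\<Phi>. \<exists>B :: 'a \<Rightarrow> 'a \<Rightarrow> bit.
     symmetric_on E B \<and> (\<forall>T\<subseteq>E. sym_diff F T \<in> \<Phi> \<longleftrightarrow> nondegenerate B T))"

text \<open>Feasibility of \<open>Y\<close> in the twist means that \<open>A\<close> is
  nondegenerate on \<open>sym_diff Y X\<close>; pivoting at \<open>sym_diff F X\<close> moves the
  base point to \<open>F\<close>.\<close>

lemma binary_delta_matroid_pivotable:
  assumes "binary_delta_matroid (E, \<Phi>)"
  shows "pivotable E \<Phi>"
  unfolding pivotable_def
proof
  fix F assume F: "F \<in> \<Phi>"
  have fin: "finite E" using assms by (simp add: binary_delta_matroid_def)
  from assms obtain A X where A: "symmetric_on E A" and X: "X \<subseteq> E"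
    and eq: "(E, \<Phi>) = twist (matrix_set_system E A) X"
    by (auto simp: binary_delta_matroid_def)
  have \<Phi>: "Y \<in> \<Phi> \<longleftrightarrow> nondegenerate A (sym_diff Y X)" if Y: "Y \<subseteq> E" for Y
  proof -
    have "Y \<in> \<Phi> \<longleftrightarrow> sym_diff Y X \<in> {X. X \<subseteq> E \<and> principal_minor A X \<noteq> 0}"
    proof
      assume "Y \<in> \<Phi>"
      then obtain W where "W \<in> {X. X \<subseteq> E \<and> principal_minor A X \<noteq> 0}" "Y = sym_diff W X"
        using eq by (auto simp: matrix_set_system_def)
      moreover from this have "sym_diff Y X = W" by blast
      ultimately show "sym_diff Y X \<in> {X. X \<subseteq> E \<and> principal_minor A X \<noteq> 0}" by simp
    next
      assume "sym_diff Y X \<in> {X. X \<subseteq> E \<and> principal_minor A X \<noteq> 0}"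
      moreover have "Y = sym_diff (sym_diff Y X) X" by blast
      ultimately show "Y \<in> \<Phi>" using eq unfolding matrix_set_system_def twist.simps by blast
    qed
    also have "\<dots> \<longleftrightarrow> nondegenerate A (sym_diff Y X)"
    proof -
      have "sym_diff Y X \<subseteq> E" using X Y by blast
      moreover from this have "finite (sym_diff Y X)" using fin by (rule finite_subset)
      ultimately show ?thesis
        using principal_minor_nonzero_iff_nondegenerate[of "sym_diff Y X" A] by blast
    qed
    finally show ?thesis .
  qed
  have FE: "F \<subseteq> E" using assms F by (auto simp: binary_delta_matroid_def)
  have G: "sym_diff F X \<subseteq> E" using FE X by blast
  have nd: "nondegenerate A (sym_diff F X)" using \<Phi>[OF FE] F by simp
  obtain B :: "'a \<Rightarrow> 'a \<Rightarrow> bit" where B: "symmetric_on E B"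
    "\<forall>T\<subseteq>E. nondegenerate A (sym_diff (sym_diff F X) T) \<longleftrightarrow> nondegenerate B T"
    using principal_pivot[OF fin A G nd] by metis
  have "sym_diff F T \<in> \<Phi> \<longleftrightarrow> nondegenerate B T" if T: "T \<subseteq> E" for T
  proof -
    have "sym_diff (sym_diff F T) X = sym_diff (sym_diff F X) T" by blast
    moreover have "sym_diff F T \<subseteq> E" using FE T by blast
    ultimately show ?thesis using \<Phi>[of "sym_diff F T"] B(2) T by simp
  qed
  then show "\<exists>B :: 'a \<Rightarrow> 'a \<Rightarrow> bit. symmetric_on E B \<and>
      (\<forall>T\<subseteq>E. sym_diff F T \<in> \<Phi> \<longleftrightarrow> nondegenerate B T)"
    using B(1) by blast
qed

text \<open>The base point is the feasible set over \<open>Z\<close> with corner bits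
  \<open>s\<close>, \<open>t\<close>. Its symmetric difference with a set of bits \<open>p\<close>,
  \<open>q\<close> has the exclusive ors \<open>s \<noteq> p\<close> and \<open>t \<noteq> q\<close>
  as corner bits.\<close>

lemma fibre_pivot:
  assumes "pivotable E \<Phi>" "a \<in> E" "b \<in> E" "a \<noteq> b" "Z \<subseteq> E - {a, b}" "fibre a b \<Phi> Z s t"
  obtains B :: "'a \<Rightarrow> 'a \<Rightarrow> bit" where "symmetric_on E B"
    and "\<And>G p q. G \<subseteq> E - {a, b} \<Longrightarrow>
      fibre a b \<Phi> (sym_diff Z G) p q \<longleftrightarrow> nondegenerate B (G \<union> corner a b (s \<noteq> p) (t \<noteq> q))"
proof -
  let ?F = "Z \<union> corner a b s t"
  obtain B :: "'a \<Rightarrow> 'a \<Rightarrow> bit" where B: "symmetric_on E B"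
    "\<And>T. T \<subseteq> E \<Longrightarrow> sym_diff ?F T \<in> \<Phi> \<longleftrightarrow> nondegenerate B T"
    using assms(1,6) unfolding pivotable_def fibre_def by blast
  have "fibre a b \<Phi> (sym_diff Z G) p q \<longleftrightarrow> nondegenerate B (G \<union> corner a b (s \<noteq> p) (t \<noteq> q))"
    if G: "G \<subseteq> E - {a, b}" for G p q
  proof -
    let ?T = "G \<union> corner a b (s \<noteq> p) (t \<noteq> q)"
    have "sym_diff Z G \<union> corner a b p q = sym_diff ?F ?T"
      using G assms(4,5) unfolding corner_def by (cases s; cases t; cases p; cases q) auto
    moreover have "?T \<subseteq> E" using G assms(2,3) by (auto simp: corner_def)
    ultimately show ?thesis using B(2)[of ?T] by (simp add: fibre_def)
  qed
  with B(1) show thesis by (rule that)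
qed

section \<open>Fibres over subsets that differ in one or two elements\<close>

lemma corner_simps:
  "corner a b False False = {}" "corner a b True False = {a}"
  "corner a b False True = {b}" "corner a b True True = {a, b}"
  by (auto simp: corner_def)

text \<open>Pivot over \<open>Z\<close>. Emptiness over \<open>sym_diff Z {x}\<close> forces
  \<open>B x x\<close>, \<open>B x a\<close> and \<open>B x b\<close> to vanish, while a feasible
  set over \<open>sym_diff Z {x, y}\<close> forces \<open>B x y\<close> to be nonzero. Then
  \<open>x\<close> and \<open>y\<close> form a hyperbolic pair, whose removal does not affect
  nondegeneracy.\<close>

lemma fibre_eq_across_empty:
  assumes piv: "pivotable E \<Phi>" and ab: "a \<in> E" "b \<in> E" "a \<noteq> b"
    and Z: "Z \<subseteq> E - {a, b}" and xy: "x \<in> E - {a, b}" "y \<in> E - {a, b}" "x \<noteq> y"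
    and ne: "fibre a b \<Phi> Z s t" and empty: "\<And>p q. \<not> fibre a b \<Phi> (sym_diff Z {x}) p q"
    and ne': "fibre a b \<Phi> (sym_diff Z {x, y}) s' t'"
  shows "fibre a b \<Phi> (sym_diff Z {x, y}) = fibre a b \<Phi> Z"
proof -
  obtain B :: "'a \<Rightarrow> 'a \<Rightarrow> bit" where symB: "symmetric_on E B"
    and B: "\<And>G p q. G \<subseteq> E - {a, b} \<Longrightarrow>
      fibre a b \<Phi> (sym_diff Z G) p q \<longleftrightarrow> nondegenerate B (G \<union> corner a b (s \<noteq> p) (t \<noteq> q))"
    using fibre_pivot[OF piv ab Z ne] by blast
  have sym: "B i j = B j i" if "i \<in> E" "j \<in> E" for i j
    using symB that by (simp add: symmetric_on_def)
  have e: "\<not> nondegenerate B ({x} \<union> corner a b p q)" for p q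
  proof -
    have "\<not> nondegenerate B ({x} \<union> corner a b (s \<noteq> (s \<noteq> p)) (t \<noteq> (t \<noteq> q)))"
      using B[of "{x}" "s \<noteq> p" "t \<noteq> q"] empty xy(1) by blast
    moreover have "(s \<noteq> (s \<noteq> p)) = p" "(t \<noteq> (t \<noteq> q)) = q" by auto
    ultimately show ?thesis by simp
  qed
  have Bxx: "B x x = 0"
    using e[of False False] by (simp add: corner_simps nondegenerate_singleton)
  have Bxa: "B x a = 0"
  proof -
    have "x \<noteq> a" using xy by auto
    then have "B x x * B a a + B x a * B a x \<noteq> 1"
      using e[of True False] nondegenerate_doubleton[of x a B]
      by (simp add: corner_simps insert_commute)
    then show ?thesis using Bxx sym[of a x] ab xy by (cases "B x a") auto
  qed
  have Bxb: "B x b = 0"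
  proof -
    have "x \<noteq> b" using xy by auto
    then have "B x x * B b b + B x b * B b x \<noteq> 1"
      using e[of False True] nondegenerate_doubleton[of x b B]
      by (simp add: corner_simps insert_commute)
    then show ?thesis using Bxx sym[of b x] ab xy by (cases "B x b") auto
  qed
  have corner_sub: "corner a b p q \<subseteq> {a, b}" for p q by (auto simp: corner_def)
  have xT: "B x i = 0" "B i x = 0" if "i \<in> corner a b p q" for i p q
  proof -
    have "i = a \<or> i = b" using that by (auto simp: corner_def)
    then show "B x i = 0" "B i x = 0" using Bxa Bxb sym[of i x] ab xy by auto
  qed
  have fin_corner: "finite (corner a b p q)" for p q
    using corner_sub finite_subset by blast
  \<comment> \<open>Column \<open>x\<close> needs a nonzero entry, and only row \<open>y\<close> is
    left to carry it.\<close>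
  have Bxy: "B x y \<noteq> 0"
  proof -
    let ?X = "{x, y} \<union> corner a b (s \<noteq> s') (t \<noteq> t')"
    have "nondegenerate B ?X" using B[of "{x, y}" s' t'] ne' xy by blast
    then obtain i where i: "i \<in> ?X" "B i x \<noteq> 0"
      using nondegenerate_column_nonzero[of B ?X x] fin_corner by auto
    then have "i = y" using Bxx xT(2) by auto
    then show ?thesis using i(2) sym[of x y] xy by simp
  qed
  have "fibre a b \<Phi> (sym_diff Z {x, y}) p q = fibre a b \<Phi> Z p q" for p q
  proof -
    let ?T = "corner a b (s \<noteq> p) (t \<noteq> q)"
    have "nondegenerate B (insert x (insert y ?T)) \<longleftrightarrow> nondegenerate B ?T"
    proof (rule nondegenerate_hyperbolic_pair)
      show "x \<notin> ?T" "y \<notin> ?T" using xy corner_sub by auto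
      show "B y x \<noteq> 0" using Bxy sym[of x y] xy by simp
    qed (use xy Bxx xT Bxy fin_corner in auto)
    moreover have "{x, y} \<union> ?T = insert x (insert y ?T)" by blast
    ultimately show ?thesis using B[of "{x, y}" p q] B[of "{}" p q] xy by simp
  qed
  then show ?thesis by blast
qed

text \<open>
  After pivoting this is the expansion modulo 2 of a symmetric \<open>3 \<times> 3\<close> determinant in terms of
  its principal minors.
\<close>

lemma neighbouring_fibres_even_pairing:
  assumes piv: "pivotable E \<Phi>" and ab: "a \<in> E" "b \<in> E" "a \<noteq> b"
    and Z: "Z \<subseteq> E - {a, b}" and x: "x \<in> E - {a, b}"
  shows "\<not> odd_pairing (fibre a b \<Phi> (sym_diff Z {x})) (fibre a b \<Phi> Z)"
proof (cases "\<exists>s t. fibre a b \<Phi> Z s t")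
  \<comment> \<open>There is no feasible set to pivot at, but an empty fibre contributes nothing to
    the pairing.\<close>
  case False
  then show ?thesis by (simp add: odd_pairing_def)
next
  case True
  then obtain s t where ne: "fibre a b \<Phi> Z s t" by blast
  obtain B :: "'a \<Rightarrow> 'a \<Rightarrow> bit" where symB: "symmetric_on E B"
    and B: "\<And>G p q. G \<subseteq> E - {a, b} \<Longrightarrow>
      fibre a b \<Phi> (sym_diff Z G) p q \<longleftrightarrow> nondegenerate B (G \<union> corner a b (s \<noteq> p) (t \<noteq> q))"
    using fibre_pivot[OF piv ab Z ne] by blast
  have sym: "B i j = B j i" if "i \<in> E" "j \<in> E" for i j
    using symB that by (simp add: symmetric_on_def)
  have d: "x \<noteq> a" "x \<noteq> b" using x by auto
  have B0: "fibre a b \<Phi> Z p q \<longleftrightarrow> nondegenerate B (corner a b (s \<noteq> p) (t \<noteq> q))" for p q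
    using B[of "{}" p q] by simp
  have Bx: "fibre a b \<Phi> (sym_diff Z {x}) p q \<longleftrightarrow>
      nondegenerate B (insert x (corner a b (s \<noteq> p) (t \<noteq> q)))" for p q
    using B[of "{x}" p q] x by simp
  have tri: "nondegenerate B {x, a, b} \<longleftrightarrow>
    B x x * B a a * B b b + B x x * B a b + B a a * B x b + B b b * B x a = 1"
    by (rule nondegenerate_tripleton) (use d ab x sym in auto)
  have syms: "B a x = B x a" "B b x = B x b" "B b a = B a b" using sym ab x by auto
  show ?thesis
    unfolding odd_pairing_def B0 Bx
    using ab(3) d
    by (cases s; cases t; cases "B x x"; cases "B a a"; cases "B b b";
        cases "B x a"; cases "B x b"; cases "B a b")
      (simp_all add: corner_simps nondegenerate_empty nondegenerate_singleton
        nondegenerate_doubleton tri syms)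
qed

text \<open>Apply the exchange axiom at \<open>x\<close>. A partner equal to \<open>x\<close>,
  \<open>a\<close> or \<open>b\<close> leads to a set over \<open>sym_diff Z {x}\<close>; any other
  partner lies in \<open>sym_diff Z Z'\<close>.\<close>

lemma fibre_exchange:
  assumes dm: "delta_matroid (E, \<Phi>)" and ab: "a \<noteq> b"
    and Z: "Z \<subseteq> E - {a, b}" "Z' \<subseteq> E - {a, b}"
    and ne: "fibre a b \<Phi> Z s t" "fibre a b \<Phi> Z' s' t'" and x: "x \<in> sym_diff Z Z'"
  obtains p q where "fibre a b \<Phi> (sym_diff Z {x}) p q"
  | y p q where "y \<in> sym_diff Z Z'" "y \<noteq> x" "fibre a b \<Phi> (sym_diff Z {x, y}) p q"
proof -
  let ?X = "Z \<union> corner a b s t" and ?Y = "Z' \<union> corner a b s' t'"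
  have xab: "x \<noteq> a" "x \<noteq> b" using x Z by auto
  have "x \<in> sym_diff ?X ?Y" using x xab by (auto simp: corner_def)
  then obtain y where y: "y \<in> sym_diff ?X ?Y" "sym_diff {x, y} ?X \<in> \<Phi>"
    using dm ne unfolding fibre_def delta_matroid.simps by blast
  consider "y = x" | "y = a" | "y = b" | "y \<noteq> x" "y \<noteq> a" "y \<noteq> b" by blast
  then show thesis
  proof cases
    case 1
    have "sym_diff {x, y} ?X = sym_diff Z {x} \<union> corner a b s t"
      using 1 xab by (auto simp: corner_def)
    then show ?thesis using y(2) by (intro that(1)[of s t]) (simp add: fibre_def)
  next
    case 2
    have "sym_diff {x, y} ?X = sym_diff Z {x} \<union> corner a b (\<not> s) t"
      using 2 xab ab Z(1) unfolding corner_def by (cases s; cases t) auto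
    then show ?thesis using y(2) by (intro that(1)[of "\<not> s" t]) (simp add: fibre_def)
  next
    case 3
    have "sym_diff {x, y} ?X = sym_diff Z {x} \<union> corner a b s (\<not> t)"
      using 3 xab ab Z(1) unfolding corner_def by (cases s; cases t) auto
    then show ?thesis using y(2) by (intro that(1)[of s "\<not> t"]) (simp add: fibre_def)
  next
    case 4
    have "sym_diff {x, y} ?X = sym_diff Z {x, y} \<union> corner a b s t"
      using 4 xab by (auto simp: corner_def)
    moreover have "y \<in> sym_diff Z Z'" using y(1) 4 by (auto simp: corner_def)
    ultimately show ?thesis using y(2) 4 by (intro that(2)[of y s t]) (simp_all add: fibre_def)
  qed
qed

section \<open>Fibres closest and second closest to a given subset\<close>

lemma card_sym_diff_singleton:
  assumes "finite U"
  shows "x \<in> U \<Longrightarrow> Suc (card (sym_diff U {x})) = card U"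
    and "x \<notin> U \<Longrightarrow> card (sym_diff U {x}) = Suc (card U)"
proof -
  assume "x \<in> U"
  moreover from this have "sym_diff U {x} = U - {x}" by blast
  ultimately show "Suc (card (sym_diff U {x})) = card U"
    using assms card_Suc_Diff1[of U x] by simp
next
  assume "x \<notin> U"
  moreover from this have "sym_diff U {x} = insert x U" by blast
  ultimately show "card (sym_diff U {x}) = Suc (card U)" using assms by simp
qed

lemma sym_diff_step: "sym_diff (sym_diff Z {x}) Y = sym_diff (sym_diff Z Y) {x}"
  by blast

lemma sym_diff_double_step:
  "x \<noteq> y \<Longrightarrow> sym_diff (sym_diff Z {x, y}) Y = sym_diff (sym_diff (sym_diff Z Y) {x}) {y}"
  by blast

locale binary_fibres =
  fixes E :: "'a set" and \<Phi> :: "'a set set" and a b :: 'a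
  assumes dm: "delta_matroid (E, \<Phi>)" and piv: "pivotable E \<Phi>"
    and a: "a \<in> E" and b: "b \<in> E" and ab: "a \<noteq> b"
begin

abbreviation "W \<equiv> E - {a, b}"
abbreviation "g \<equiv> fibre a b \<Phi>"

lemma finite_E: "finite E"
  using dm by simp

lemma finite_W_subset: "Z \<subseteq> W \<Longrightarrow> finite Z"
  using finite_E by (metis finite_Diff finite_subset)

text \<open>The inductive step shared by the next two lemmas, at minimal distance from
  \<open>Y\<close> and at one more. Exchange at \<open>x\<close> gives a partner \<open>y\<close>,
  and the fibre is copied across the empty one to \<open>sym_diff Z {x, y}\<close>. Both elements
  lie in \<open>sym_diff Z Z'\<close>, so this moves closer to \<open>Z'\<close>.\<close>

lemma step_towards:
  assumes sub: "Y \<subseteq> W" "Z \<subseteq> W" "Z' \<subseteq> W"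
    and ne: "g Z s t" "g Z' s' t'"
    and low: "\<forall>Z\<subseteq>W. \<forall>p q. g Z p q \<longrightarrow> card (sym_diff Z' Y) \<le> card (sym_diff Z Y)"
    and near: "card (sym_diff Z Y) \<le> Suc (card (sym_diff Z' Y))"
    and x: "x \<in> sym_diff Z Y" "x \<notin> sym_diff Z' Y"
    and empty: "\<forall>p q. \<not> g (sym_diff Z {x}) p q"
  obtains U where "U \<subseteq> W" "g U = g Z" "card (sym_diff U Y) = card (sym_diff Z Y)"
    "card (sym_diff U Z') < card (sym_diff Z Z')"
proof -
  have xZ: "x \<in> sym_diff Z Z'" using x by blast
  obtain y p q where y: "y \<in> sym_diff Z Z'" "y \<noteq> x" "g (sym_diff Z {x, y}) p q"
    using fibre_exchange[OF dm ab sub(2,3) ne xZ] empty by metis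
  have xyW: "x \<in> W" "y \<in> W" using x y sub by auto
  let ?U = "sym_diff Z {x, y}"
  have U: "?U \<subseteq> W" using xyW sub by auto
  have gU: "g ?U = g Z"
    by (rule fibre_eq_across_empty[OF piv a b ab sub(2) xyW(1,2) y(2)[symmetric]
          ne(1) empty[rule_format] y(3)])
  have fin: "finite (sym_diff Z Y)" "finite (sym_diff Z Z')"
    using sub finite_W_subset by auto
  have fin1: "finite (sym_diff (sym_diff Z Y) {x})" "finite (sym_diff (sym_diff Z Z') {x})"
    using fin by simp_all
  have "card (sym_diff ?U Z') < card (sym_diff Z Z')"
  proof -
    have "y \<in> sym_diff (sym_diff Z Z') {x}" using y by blast
    then show ?thesis
      using card_sym_diff_singleton(1)[OF fin(2) xZ] card_sym_diff_singleton(1)[OF fin1(2)]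
        sym_diff_double_step[OF y(2)[symmetric], of Z Z'] by fastforce
  qed
  moreover have "card (sym_diff ?U Y) = card (sym_diff Z Y)"
  proof -
    have s: "Suc (card (sym_diff (sym_diff Z Y) {x})) = card (sym_diff Z Y)"
      by (rule card_sym_diff_singleton(1)[OF fin(1) x(1)])
    have l: "card (sym_diff Z' Y) \<le> card (sym_diff ?U Y)" by (rule low[rule_format, OF U y(3)])
    have e: "sym_diff ?U Y = sym_diff (sym_diff (sym_diff Z Y) {x}) {y}"
      by (rule sym_diff_double_step) (use y(2) in simp)
    \<comment> \<open>Toggling \<open>x\<close> lowers the distance to \<open>Y\<close> by one. If
      \<open>y\<close> lowered it again, \<open>near\<close> would put it below the minimum in
      \<open>low\<close>; so \<open>y\<close> raises it back.\<close>
    show ?thesis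
    proof (cases "y \<in> sym_diff (sym_diff Z Y) {x}")
      case True
      have "Suc (card (sym_diff ?U Y)) = card (sym_diff (sym_diff Z Y) {x})"
        unfolding e by (rule card_sym_diff_singleton(1)[OF fin1(1) True])
      then show ?thesis using s l near by linarith
    next
      case False
      have "card (sym_diff ?U Y) = Suc (card (sym_diff (sym_diff Z Y) {x}))"
        unfolding e by (rule card_sym_diff_singleton(2)[OF fin1(1) False])
      then show ?thesis using s by linarith
    qed
  qed
  ultimately show thesis using that[OF U gU] by blast
qed

text \<open>Induction on the distance from \<open>Z\<close> to \<open>Z'\<close>. If they differ,
  equal distances to \<open>Y\<close> give an \<open>x\<close> whose toggling brings
  \<open>Z\<close> closer to \<open>Y\<close>; minimality makes the fibre there empty, and
  \<open>step_towards\<close> applies.\<close>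

lemma closest_fibres_eq:
  assumes sub: "Y \<subseteq> W" "Z \<subseteq> W" "Z' \<subseteq> W"
    and ne: "g Z s t" "g Z' s' t'"
    and low: "\<forall>Z\<subseteq>W. \<forall>p q. g Z p q \<longrightarrow> card (sym_diff Z' Y) \<le> card (sym_diff Z Y)"
    and eq: "card (sym_diff Z Y) = card (sym_diff Z' Y)"
  shows "g Z = g Z'"
  using sub(2) ne(1) eq
proof (induction "card (sym_diff Z Z')" arbitrary: Z rule: less_induct)
  case less
  have fin: "finite (sym_diff Z Y)" "finite (sym_diff Z' Y)"
    using less.prems sub finite_W_subset by auto
  show ?case
  proof (cases "sym_diff Z Y \<subseteq> sym_diff Z' Y")
    case True
    then have "sym_diff Z Y = sym_diff Z' Y" using fin(2) less.prems(3) by (simp add: card_subset_eq)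
    then have "Z = Z'" by blast
    then show ?thesis by simp
  next
    case False
    then obtain x where x: "x \<in> sym_diff Z Y" "x \<notin> sym_diff Z' Y" by blast
    have xW: "x \<in> W" using x less.prems(1) sub(1) by blast
    have empty: "\<forall>p q. \<not> g (sym_diff Z {x}) p q"
    proof (intro allI notI)
      fix p q assume pq: "g (sym_diff Z {x}) p q"
      have Zx: "sym_diff Z {x} \<subseteq> W" using xW less.prems(1) by blast
      have "card (sym_diff Z' Y) \<le> card (sym_diff (sym_diff Z {x}) Y)"
        by (rule low[rule_format, OF Zx pq])
      then show False
        using card_sym_diff_singleton(1)[OF fin(1) x(1)] less.prems(3) by (simp add: sym_diff_step)
    qed
    obtain U where U: "U \<subseteq> W" "g U = g Z" "card (sym_diff U Y) = card (sym_diff Z Y)"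
      "card (sym_diff U Z') < card (sym_diff Z Z')"
      by (rule step_towards[OF sub(1) less.prems(1) sub(3) less.prems(2) ne(2) low _ x empty])
        (use less.prems(3) in simp)
    have "g U = g Z'"
      using less.hyps[OF U(4) U(1)] U(2,3) less.prems(2,3) by simp
    then show ?thesis using U(2) by simp
  qed
qed

text \<open>Toggling a suitable \<open>x\<close> brings \<open>Z\<close> to minimal distance. If the
  fibre there is nonempty, it equals \<open>g Z'\<close> and neighbours that of \<open>Z\<close>;
  otherwise \<open>step_towards\<close> carries a nonempty \<open>g Z\<close> closer to
  \<open>Z'\<close>.\<close>

lemma second_closest_fibres_even_pairing:
  assumes sub: "Y \<subseteq> W" "Z \<subseteq> W" "Z' \<subseteq> W"
    and ne: "g Z' s' t'"
    and low: "\<forall>Z\<subseteq>W. \<forall>p q. g Z p q \<longrightarrow> card (sym_diff Z' Y) \<le> card (sym_diff Z Y)"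
    and eq: "card (sym_diff Z Y) = Suc (card (sym_diff Z' Y))"
  shows "\<not> odd_pairing (g Z') (g Z)"
  using sub(2) eq
proof (induction "card (sym_diff Z Z')" arbitrary: Z rule: less_induct)
  case less
  have fin: "finite (sym_diff Z Y)" "finite (sym_diff Z' Y)"
    using less.prems sub finite_W_subset by auto
  have "\<not> sym_diff Z Y \<subseteq> sym_diff Z' Y"
    using card_mono[OF fin(2), of "sym_diff Z Y"] less.prems(2) by (intro notI) linarith
  then obtain x where x: "x \<in> sym_diff Z Y" "x \<notin> sym_diff Z' Y" by blast
  have xW: "x \<in> W" using x less.prems(1) sub(1) by blast
  show ?case
  proof (cases "\<exists>p q. g (sym_diff Z {x}) p q")
    case True
    then obtain p q where pq: "g (sym_diff Z {x}) p q" by blast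
    have Zx: "sym_diff Z {x} \<subseteq> W" using xW less.prems(1) by blast
    have "card (sym_diff (sym_diff Z {x}) Y) = card (sym_diff Z' Y)"
      using card_sym_diff_singleton(1)[OF fin(1) x(1)] less.prems(2) by (simp add: sym_diff_step)
    then have "g (sym_diff Z {x}) = g Z'"
      by (rule closest_fibres_eq[OF sub(1) Zx sub(3) pq ne low])
    then show ?thesis
      using neighbouring_fibres_even_pairing[OF piv a b ab less.prems(1) xW] by simp
  next
    case empty: False
    show ?thesis
    proof (cases "\<exists>p q. g Z p q")
      case True
      then obtain p q where pq: "g Z p q" by blast
      obtain U where U: "U \<subseteq> W" "g U = g Z" "card (sym_diff U Y) = card (sym_diff Z Y)"
        "card (sym_diff U Z') < card (sym_diff Z Z')"
        by (rule step_towards[OF sub(1) less.prems(1) sub(3) pq ne low _ x])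
          (use less.prems(2) empty in simp_all)
      show ?thesis using less.hyps[OF U(4) U(1)] U(2,3) less.prems(2) by simp
    next
      case False
      then show ?thesis by (simp add: odd_pairing_def)
    qed
  qed
qed

end

text \<open>Collects what determines the distances to the sets over \<open>Y\<close>, for arbitrary
  \<open>W\<close> and \<open>g\<close> so that it can be transported along fibrewise operations.
  The last clause includes empty fibres, whose pairing is even.\<close>

definition nearest_fibre ::
  "'a set \<Rightarrow> ('a set \<Rightarrow> bool \<Rightarrow> bool \<Rightarrow> bool) \<Rightarrow> 'a set \<Rightarrow> nat \<Rightarrow> (bool \<Rightarrow> bool \<Rightarrow> bool) \<Rightarrow> bool" where
  "nearest_fibre W g Y c P \<longleftrightarrow>
     (\<exists>s t. P s t) \<and>
     (\<exists>Z\<subseteq>W. card (sym_diff Z Y) = c \<and> g Z = P) \<and>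
     (\<forall>Z\<subseteq>W. \<forall>s t. g Z s t \<longrightarrow> c \<le> card (sym_diff Z Y)) \<and>
     (\<forall>Z\<subseteq>W. \<forall>s t. g Z s t \<longrightarrow> card (sym_diff Z Y) = c \<longrightarrow> g Z = P) \<and>
     (\<forall>Z\<subseteq>W. card (sym_diff Z Y) = Suc c \<longrightarrow> \<not> odd_pairing P (g Z))"

lemma (in binary_fibres) nearest_fibre_exists:
  assumes "Y \<subseteq> W"
  shows "\<exists>c P. nearest_fibre W g Y c P"
proof -
  define N where "N Z \<longleftrightarrow> Z \<subseteq> W \<and> (\<exists>s t. g Z s t)" for Z
  obtain F where F: "F \<in> \<Phi>" "F \<subseteq> E" using dm by auto
  have "F = (F - {a, b}) \<union> corner a b (a \<in> F) (b \<in> F)" by (auto simp: corner_def)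
  then have "g (F - {a, b}) (a \<in> F) (b \<in> F)" using F by (simp add: fibre_def)
  then have "N (F - {a, b})" using F unfolding N_def by blast
  then obtain Z' where Z': "N Z'" "\<forall>Z. N Z \<longrightarrow> card (sym_diff Z' Y) \<le> card (sym_diff Z Y)"
    using ex_has_least_nat[of N "F - {a, b}" "\<lambda>Z. card (sym_diff Z Y)"] by metis
  obtain s' t' where ne: "g Z' s' t'" and sub: "Z' \<subseteq> W" using Z'(1) unfolding N_def by blast
  have low: "\<forall>Z\<subseteq>W. \<forall>p q. g Z p q \<longrightarrow> card (sym_diff Z' Y) \<le> card (sym_diff Z Y)"
    using Z'(2) unfolding N_def by simp
  have "nearest_fibre W g Y (card (sym_diff Z' Y)) (g Z')"
    unfolding nearest_fibre_def
  proof (intro conjI)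
    show "\<exists>s t. g Z' s t" using ne by blast
    show "\<exists>Z\<subseteq>W. card (sym_diff Z Y) = card (sym_diff Z' Y) \<and> g Z = g Z'" using sub by blast
    show "\<forall>Z\<subseteq>W. \<forall>s t. g Z s t \<longrightarrow> card (sym_diff Z' Y) \<le> card (sym_diff Z Y)" by (rule low)
    show "\<forall>Z\<subseteq>W. \<forall>s t. g Z s t \<longrightarrow> card (sym_diff Z Y) = card (sym_diff Z' Y) \<longrightarrow> g Z = g Z'"
      using closest_fibres_eq[OF assms _ sub _ ne low] by meson
    show "\<forall>Z\<subseteq>W. card (sym_diff Z Y) = Suc (card (sym_diff Z' Y)) \<longrightarrow> \<not> odd_pairing (g Z') (g Z)"
      using second_closest_fibres_even_pairing[OF assms _ sub ne low] by meson
  qed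
  then show ?thesis by blast
qed

section \<open>The operations on fibres and the interlace polynomial\<close>

text \<open>With membership bits as coordinates over the two-element field, this adds the coordinate
  of \<open>{}\<close> to that of \<open>{a, b}\<close>; \<open>slide_corner\<close> adds that of
  \<open>{b}\<close> to that of \<open>{a}\<close>. Addition is \<open>\<noteq>\<close> on truth
  values.\<close>

definition exchange_corner :: "(bool \<Rightarrow> bool \<Rightarrow> bool) \<Rightarrow> bool \<Rightarrow> bool \<Rightarrow> bool" where
  "exchange_corner P s t \<longleftrightarrow> P s t \<noteq> (s \<and> t \<and> P False False)"

definition slide_corner :: "(bool \<Rightarrow> bool \<Rightarrow> bool) \<Rightarrow> bool \<Rightarrow> bool \<Rightarrow> bool" where
  "slide_corner P s t \<longleftrightarrow> P s t \<noteq> (s \<and> \<not> t \<and> P False True)"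

text \<open>The clauses see fibres only through equality, nonemptiness and the parity pairing, all
  of which survive \<open>f\<close>. So the same \<open>c\<close> serves before and after.\<close>

lemma nearest_fibre_map:
  assumes nf: "nearest_fibre W g Y c P"
    and ne: "\<And>P. (\<exists>s t. f P s t) \<longleftrightarrow> (\<exists>s t. P s t)"
    and pairing: "\<And>P Q. odd_pairing (f P) (f Q) \<longleftrightarrow> odd_pairing P Q"
    and g': "\<And>Z. Z \<subseteq> W \<Longrightarrow> g' Z = f (g Z)"
  shows "nearest_fibre W g' Y c (f P)"
  unfolding nearest_fibre_def
proof (intro conjI)
  show "\<exists>s t. f P s t" using nf ne unfolding nearest_fibre_def by simp
  show "\<exists>Z\<subseteq>W. card (sym_diff Z Y) = c \<and> g' Z = f P"
    using nf g' unfolding nearest_fibre_def by metis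
  show "\<forall>Z\<subseteq>W. \<forall>s t. g' Z s t \<longrightarrow> c \<le> card (sym_diff Z Y)"
    using nf g' ne unfolding nearest_fibre_def by metis
  show "\<forall>Z\<subseteq>W. \<forall>s t. g' Z s t \<longrightarrow> card (sym_diff Z Y) = c \<longrightarrow> g' Z = f P"
    using nf g' ne unfolding nearest_fibre_def by metis
  show "\<forall>Z\<subseteq>W. card (sym_diff Z Y) = Suc c \<longrightarrow> \<not> odd_pairing (f P) (g' Z)"
    using nf g' pairing unfolding nearest_fibre_def by metis
qed

lemma ex_bool2_iff:
  "(\<exists>s t. P s t) \<longleftrightarrow> P False False \<or> P False True \<or> P True False \<or> P True True"
  by (metis (full_types))

lemma exchange_corner_nonempty: "(\<exists>s t. exchange_corner P s t) \<longleftrightarrow> (\<exists>s t. P s t)"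
  unfolding ex_bool2_iff by (auto simp: exchange_corner_def)

lemma slide_corner_nonempty: "(\<exists>s t. slide_corner P s t) \<longleftrightarrow> (\<exists>s t. P s t)"
  unfolding ex_bool2_iff by (auto simp: slide_corner_def)

text \<open>By bilinearity the extra term \<open>P False False \<and> Q False False\<close> appears
  twice and cancels. The handle slide works likewise with \<open>{a}\<close> and
  \<open>{b}\<close>.\<close>

lemma exchange_corner_pairing:
  "odd_pairing (exchange_corner P) (exchange_corner Q) \<longleftrightarrow> odd_pairing P Q"
  unfolding odd_pairing_def exchange_corner_def by auto

lemma slide_corner_pairing:
  "odd_pairing (slide_corner P) (slide_corner Q) \<longleftrightarrow> odd_pairing P Q"
  unfolding odd_pairing_def slide_corner_def by auto

text \<open>A set over \<open>Z\<close> can come only from \<open>X = Z\<close>, since both avoid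
  \<open>a\<close> and \<open>b\<close>. Hence the toggling stays within one fibre, and the same
  holds for the handle slide.\<close>

lemma fibre_exchange_ends:
  assumes "a \<noteq> b" "Z \<subseteq> E - {a, b}"
  shows "fibre a b (snd (exchange_ends a b (E, \<Phi>))) Z = exchange_corner (fibre a b \<Phi> Z)"
proof (intro ext)
  fix s t
  have "(\<exists>X. Z \<union> corner a b s t = X \<union> {a, b} \<and> X \<in> \<Phi> \<and> X \<subseteq> E - {a, b}) \<longleftrightarrow>
      s \<and> t \<and> Z \<in> \<Phi>" (is "?L \<longleftrightarrow> ?R")
  proof
    assume ?L
    then obtain X where X: "Z \<union> corner a b s t = X \<union> {a, b}" "X \<in> \<Phi>" "X \<subseteq> E - {a, b}" by blast
    have "a \<in> Z \<union> corner a b s t" "b \<in> Z \<union> corner a b s t" using X(1) by auto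
    then have "s \<and> t" using assms by (auto simp: corner_def)
    moreover from this have "X = Z" using X(1,3) assms(2) by (auto simp: corner_simps)
    ultimately show ?R using X(2) by simp
  next
    assume ?R
    then show ?L using assms(2) by (intro exI[of _ Z]) (auto simp: corner_simps)
  qed
  then show "fibre a b (snd (exchange_ends a b (E, \<Phi>))) Z s t = exchange_corner (fibre a b \<Phi> Z) s t"
    by (auto simp: fibre_def exchange_corner_def corner_simps)
qed

lemma fibre_handle_slide:
  assumes "a \<noteq> b" "Z \<subseteq> E - {a, b}"
  shows "fibre a b (snd (handle_slide a b (E, \<Phi>))) Z = slide_corner (fibre a b \<Phi> Z)"
proof (intro ext)
  fix s t
  have "(\<exists>X. Z \<union> corner a b s t = X \<union> {a} \<and> X \<union> {b} \<in> \<Phi> \<and> X \<subseteq> E - {a, b}) \<longleftrightarrow>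
      s \<and> \<not> t \<and> Z \<union> {b} \<in> \<Phi>" (is "?L \<longleftrightarrow> ?R")
  proof
    assume ?L
    then obtain X where X: "Z \<union> corner a b s t = X \<union> {a}" "X \<union> {b} \<in> \<Phi>" "X \<subseteq> E - {a, b}" by blast
    have "a \<in> Z \<union> corner a b s t" "b \<notin> Z \<union> corner a b s t" using X(1,3) assms(1) by auto
    then have "s \<and> \<not> t" using assms by (auto simp: corner_def)
    moreover from this have "X = Z" using X(1,3) assms(2) by (auto simp: corner_simps)
    ultimately show ?R using X(2) by simp
  next
    assume ?R
    then show ?L using assms(2) by (intro exI[of _ Z]) (auto simp: corner_simps)
  qed
  then show "fibre a b (snd (handle_slide a b (E, \<Phi>))) Z s t = slide_corner (fibre a b \<Phi> Z) s t"
    by (auto simp: fibre_def slide_corner_def corner_simps)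
qed

text \<open>For nonempty \<open>P\<close> this is the Hamming distance from the corner to
  \<open>P\<close>: if neither the corner nor a neighbour is in \<open>P\<close>, only the opposite
  corner remains.\<close>

definition corner_dist :: "(bool \<Rightarrow> bool \<Rightarrow> bool) \<Rightarrow> bool \<Rightarrow> bool \<Rightarrow> nat" where
  "corner_dist P s t = (if P s t then 0 else if P (\<not> s) t \<or> P s (\<not> t) then 1 else 2)"

lemma card_sym_diff_corner:
  assumes "a \<noteq> b" "finite Z" "finite Y" "a \<notin> Z" "b \<notin> Z" "a \<notin> Y" "b \<notin> Y"
  shows "card (sym_diff (Z \<union> corner a b p q) (Y \<union> corner a b s t)) =
    card (sym_diff Z Y) + (of_bool (p \<noteq> s) + of_bool (q \<noteq> t))"
proof -
  have "sym_diff (Z \<union> corner a b p q) (Y \<union> corner a b s t) =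
      sym_diff Z Y \<union> corner a b (p \<noteq> s) (q \<noteq> t)"
    using assms unfolding corner_def by (cases p; cases q; cases s; cases t) auto
  moreover have "card (sym_diff Z Y \<union> corner a b (p \<noteq> s) (q \<noteq> t)) =
      card (sym_diff Z Y) + card (corner a b (p \<noteq> s) (q \<noteq> t))"
    by (rule card_Un_disjoint) (use assms in \<open>auto simp: corner_def\<close>)
  moreover have "card (corner a b u v) = of_bool u + of_bool v" for u v
    using assms(1) by (cases u; cases v) (auto simp: corner_simps)
  ultimately show ?thesis by simp
qed

text \<open>The value is attained over \<open>Z'\<close>. Nonempty fibres at distance
  \<open>c\<close> all equal \<open>P\<close>, and those at distance at least \<open>c + 2\<close>
  cannot do better because a corner distance is at most 2.\<close>

lemma set_system_dist_eq_corner_dist: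
  assumes fin: "finite E" and \<Phi>: "\<Phi> \<subseteq> Pow E" and ab: "a \<noteq> b"
    and Y: "Y \<subseteq> E - {a, b}"
    and nf: "nearest_fibre (E - {a, b}) (fibre a b \<Phi>) Y c P"
  shows "set_system_dist (E, \<Phi>) (Y \<union> corner a b s t) = c + corner_dist P s t"
proof -
  let ?X = "Y \<union> corner a b s t" and ?W = "E - {a, b}" and ?g = "fibre a b \<Phi>"
  have cd: "card (sym_diff (Z \<union> corner a b p q) ?X) =
      card (sym_diff Z Y) + (of_bool (p \<noteq> s) + of_bool (q \<noteq> t))" if "Z \<subseteq> ?W" for Z p q
    by (rule card_sym_diff_corner) (use ab that Y fin finite_subset[of _ ?W] in auto)
  obtain Z' where Z': "Z' \<subseteq> ?W" "card (sym_diff Z' Y) = c" "?g Z' = P"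
    using nf unfolding nearest_fibre_def by metis
  have ex: "\<exists>p q. P p q" and
    low: "\<And>Z p q. Z \<subseteq> ?W \<Longrightarrow> ?g Z p q \<Longrightarrow> c \<le> card (sym_diff Z Y)" and
    closest: "\<And>Z p q. Z \<subseteq> ?W \<Longrightarrow> ?g Z p q \<Longrightarrow> card (sym_diff Z Y) = c \<Longrightarrow> ?g Z = P" and
    second: "\<And>Z. Z \<subseteq> ?W \<Longrightarrow> card (sym_diff Z Y) = Suc c \<Longrightarrow> \<not> odd_pairing P (?g Z)"
    using nf unfolding nearest_fibre_def by (metis, metis, metis, metis)
  have "Min ((\<lambda>F. card (sym_diff F ?X)) ` \<Phi>) = c + corner_dist P s t"
  proof (rule Min_eqI)
    show "finite ((\<lambda>F. card (sym_diff F ?X)) ` \<Phi>)"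
      using \<Phi> fin by (meson finite_Pow_iff finite_imageI finite_subset)
  next
    fix d assume "d \<in> (\<lambda>F. card (sym_diff F ?X)) ` \<Phi>"
    then obtain F where F: "F \<in> \<Phi>" "d = card (sym_diff F ?X)" by blast
    define Z p q where "Z = F - {a, b}" and "p = (a \<in> F)" and "q = (b \<in> F)"
    have F_eq: "F = Z \<union> corner a b p q" by (auto simp: corner_def Z_def p_def q_def)
    have Z: "Z \<subseteq> ?W" using F(1) \<Phi> by (auto simp: Z_def)
    have gZ: "?g Z p q" using F(1) F_eq by (simp add: fibre_def)
    have d: "d = card (sym_diff Z Y) + (of_bool (p \<noteq> s) + of_bool (q \<noteq> t))"
      using F(2) cd[OF Z] F_eq by simp
    consider "card (sym_diff Z Y) = c" | "card (sym_diff Z Y) = Suc c" | "c + 2 \<le> card (sym_diff Z Y)"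
      using low[OF Z gZ] by linarith
    then show "c + corner_dist P s t \<le> d"
    proof cases
      case 1
      then have "P p q" using closest[OF Z gZ] gZ by simp
      then show ?thesis
        using 1 d by (cases p; cases q; cases s; cases t) (auto simp: corner_dist_def)
    next
      case 2
      \<comment> \<open>A smaller value would need corner distance 2, \<open>p = s\<close> and
        \<open>q = t\<close>. Then \<open>P\<close> consists of the opposite corner alone, which is
        paired with the corner \<open>s\<close>, \<open>t\<close> over \<open>Z\<close> exactly
        once, contrary to even parity.\<close>
      have "\<not> odd_pairing P (?g Z)" by (rule second[OF Z 2])
      then show ?thesis
        using 2 d gZ ex unfolding ex_bool2_iff odd_pairing_def
        by (cases p; cases q; cases s; cases t) (auto simp: corner_dist_def)
    next
      case 3
      then show ?thesis using d by (auto simp: corner_dist_def)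
    qed
  next
    obtain p q where pq: "P p q" "of_bool (p \<noteq> s) + of_bool (q \<noteq> t) = corner_dist P s t"
    proof -
      have "\<exists>p q. P p q \<and> of_bool (p \<noteq> s) + of_bool (q \<noteq> t) = corner_dist P s t"
        using ex unfolding ex_bool2_iff corner_dist_def by (cases s; cases t) auto
      then show thesis using that by blast
    qed
    have "Z' \<union> corner a b p q \<in> \<Phi>" using pq(1) Z'(3) by (auto simp: fibre_def)
    moreover have "card (sym_diff (Z' \<union> corner a b p q) ?X) = c + corner_dist P s t"
      using cd[OF Z'(1)] Z'(2) pq(2) by simp
    ultimately show "c + corner_dist P s t \<in> (\<lambda>F. card (sym_diff F ?X)) ` \<Phi>"
      by (metis (no_types, lifting) image_eqI)
  qed
  then show ?thesis by simp
qed

section \<open>The interlace polynomial as a sum over subsets avoiding \<open>a\<close> and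
  \<open>b\<close>\<close>

lemma sum_Pow_insert:
  assumes "finite A" "x \<notin> A"
  shows "sum f (Pow (insert x A)) = (\<Sum>Y\<in>Pow A. f Y + f (insert x Y))"
proof -
  have "sum f (Pow (insert x A)) = sum f (Pow A) + sum f (insert x ` Pow A)"
    unfolding Pow_insert by (rule sum.union_disjoint) (use assms in auto)
  also have "sum f (insert x ` Pow A) = (\<Sum>Y\<in>Pow A. f (insert x Y))"
    by (rule sum.reindex_cong[of "insert x"]) (use assms in \<open>auto simp: inj_on_def\<close>)
  finally show ?thesis by (simp add: sum.distrib)
qed

lemma interlace_poly_eq_sum_corners:
  assumes "finite E" "a \<in> E" "b \<in> E" "a \<noteq> b"
  shows "interlace_poly (E, \<Phi>) = (\<Sum>Y\<in>Pow (E - {a, b}).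
    monom 1 (set_system_dist (E, \<Phi>) (Y \<union> corner a b False False)) +
    monom 1 (set_system_dist (E, \<Phi>) (Y \<union> corner a b False True)) +
    monom 1 (set_system_dist (E, \<Phi>) (Y \<union> corner a b True False)) +
    monom 1 (set_system_dist (E, \<Phi>) (Y \<union> corner a b True True)))"
proof -
  let ?f = "\<lambda>X. monom (1::int) (set_system_dist (E, \<Phi>) X)" and ?W = "E - {a, b}"
  have E: "E = insert a (insert b ?W)" using assms by blast
  have "interlace_poly (E, \<Phi>) = sum ?f (Pow (insert a (insert b ?W)))"
    unfolding interlace_poly_def fst_conv using E by simp
  also have "\<dots> = (\<Sum>Y\<in>Pow (insert b ?W). ?f Y + ?f (insert a Y))"
    by (rule sum_Pow_insert) (use assms in auto)
  also have "\<dots> = (\<Sum>Y\<in>Pow ?W. (?f Y + ?f (insert a Y)) +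
      (?f (insert b Y) + ?f (insert a (insert b Y))))"
    by (rule sum_Pow_insert) (use assms in auto)
  finally show ?thesis by (simp add: corner_simps add_ac del: set_system_dist.simps)
qed

definition corner_poly :: "(bool \<Rightarrow> bool \<Rightarrow> bool) \<Rightarrow> nat \<Rightarrow> int poly" where
  "corner_poly P c = monom 1 (c + corner_dist P False False) + monom 1 (c + corner_dist P False True) +
     monom 1 (c + corner_dist P True False) + monom 1 (c + corner_dist P True True)"

lemma interlace_poly_eq_sum_corner_poly:
  assumes fin: "finite E" and \<Phi>: "\<Phi> \<subseteq> Pow E" and ab: "a \<in> E" "b \<in> E" "a \<noteq> b"
    and nf: "\<And>Y. Y \<subseteq> E - {a, b} \<Longrightarrow> nearest_fibre (E - {a, b}) (fibre a b \<Phi>) Y (c Y) (P Y)"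
  shows "interlace_poly (E, \<Phi>) = (\<Sum>Y\<in>Pow (E - {a, b}). corner_poly (P Y) (c Y))"
  unfolding interlace_poly_eq_sum_corners[OF fin ab]
  by (rule sum.cong[OF refl])
    (simp only: Pow_iff corner_poly_def set_system_dist_eq_corner_dist[OF fin \<Phi> ab(3) _ nf])

text \<open>Unless \<open>P\<close> contains both \<open>{}\<close> and \<open>{b}\<close>, one of
  the operations changes nothing and the identity is trivial. Otherwise the exchange toggles
  \<open>{a, b}\<close> and the slide toggles \<open>{a}\<close>; each of these has a neighbour
  among \<open>{b}\<close> and \<open>{}\<close>, so a toggle alters only its own distance and the
  two effects are independent.\<close>

lemma corner_poly_four_term:
  assumes "\<exists>s t. P s t"
  shows "corner_poly P c - corner_poly (exchange_corner P) c =
    corner_poly (slide_corner P) c - corner_poly (slide_corner (exchange_corner P)) c"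
  using assms unfolding ex_bool2_iff
  by (cases "P False False"; cases "P False True"; cases "P True False"; cases "P True True")
    (simp_all add: corner_poly_def corner_dist_def exchange_corner_def slide_corner_def)

theorem theorem4:
  fixes E :: "'a set" and \<Phi> :: "'a set set" and D :: "'a set_system" and a b :: 'a
  assumes "D = (E, \<Phi>)"
    and "binary_delta_matroid D"
    and "a \<in> E" and "b \<in> E" and "a \<noteq> b"
  shows "interlace_poly D - interlace_poly (exchange_ends a b D) =
         interlace_poly (handle_slide a b D) - interlace_poly (handle_slide a b (exchange_ends a b D))"
proof -
  let ?W = "E - {a, b}"
  have bin: "binary_delta_matroid (E, \<Phi>)" using assms by simp
  then have dm: "delta_matroid (E, \<Phi>)" by (simp add: binary_delta_matroid_def)
  interpret binary_fibres E \<Phi> a b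
    by unfold_locales (use assms dm binary_delta_matroid_pivotable[OF bin] in auto)
  define \<Phi>1 where "\<Phi>1 = snd (exchange_ends a b (E, \<Phi>))"
  define \<Phi>2 where "\<Phi>2 = snd (handle_slide a b (E, \<Phi>))"
  define \<Phi>3 where "\<Phi>3 = snd (handle_slide a b (E, \<Phi>1))"
  have eqs: "exchange_ends a b D = (E, \<Phi>1)" "handle_slide a b D = (E, \<Phi>2)"
    "handle_slide a b (E, \<Phi>1) = (E, \<Phi>3)"
    using assms(1) by (simp_all add: \<Phi>1_def \<Phi>2_def \<Phi>3_def)
  have sub: "\<Phi> \<subseteq> Pow E" using dm by simp
  have sub1: "\<Phi>1 \<subseteq> Pow E" using sub a b unfolding \<Phi>1_def by auto
  have sub2: "\<Phi>2 \<subseteq> Pow E" using sub a b unfolding \<Phi>2_def by auto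
  have sub3: "\<Phi>3 \<subseteq> Pow E" using sub1 a b unfolding \<Phi>3_def by auto
  obtain c P where nf: "\<And>Y. Y \<subseteq> ?W \<Longrightarrow> nearest_fibre ?W g Y (c Y) (P Y)"
    using nearest_fibre_exists by metis
  have nf1: "nearest_fibre ?W (fibre a b \<Phi>1) Y (c Y) (exchange_corner (P Y))" if "Y \<subseteq> ?W" for Y
    unfolding \<Phi>1_def
    by (rule nearest_fibre_map[where f = exchange_corner, OF nf[OF that] exchange_corner_nonempty exchange_corner_pairing
          fibre_exchange_ends[OF ab]])
  have nf2: "nearest_fibre ?W (fibre a b \<Phi>2) Y (c Y) (slide_corner (P Y))" if "Y \<subseteq> ?W" for Y
    unfolding \<Phi>2_def
    by (rule nearest_fibre_map[where f = slide_corner, OF nf[OF that] slide_corner_nonempty slide_corner_pairing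
          fibre_handle_slide[OF ab]])
  have nf3: "nearest_fibre ?W (fibre a b \<Phi>3) Y (c Y) (slide_corner (exchange_corner (P Y)))"
    if "Y \<subseteq> ?W" for Y
    unfolding \<Phi>3_def
    by (rule nearest_fibre_map[where f = slide_corner, OF nf1[OF that] slide_corner_nonempty slide_corner_pairing
          fibre_handle_slide[OF ab]])
  note poly = interlace_poly_eq_sum_corner_poly[OF finite_E _ a b ab]
  have ne: "\<exists>s t. P Y s t" if "Y \<subseteq> ?W" for Y
    using nf[OF that] unfolding nearest_fibre_def by simp
  have poly0: "interlace_poly (E, \<Phi>) = (\<Sum>Y\<in>Pow ?W. corner_poly (P Y) (c Y))"
    by (rule poly[OF sub nf])
  have poly1: "interlace_poly (E, \<Phi>1) = (\<Sum>Y\<in>Pow ?W. corner_poly (exchange_corner (P Y)) (c Y))"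
    by (rule poly[OF sub1 nf1])
  have poly2: "interlace_poly (E, \<Phi>2) = (\<Sum>Y\<in>Pow ?W. corner_poly (slide_corner (P Y)) (c Y))"
    by (rule poly[OF sub2 nf2])
  have poly3: "interlace_poly (E, \<Phi>3) =
      (\<Sum>Y\<in>Pow ?W. corner_poly (slide_corner (exchange_corner (P Y))) (c Y))"
    by (rule poly[OF sub3 nf3])
  \<comment> \<open>All four sums have the same index set and the same offsets \<open>c Y\<close>,
    so the identity is compared term by term.\<close>
  show ?thesis
    unfolding eqs unfolding assms(1) poly0 poly1 poly2 poly3 sum_subtractf[symmetric]
    by (rule sum.cong[OF refl], rule corner_poly_four_term, rule ne) simp
qed

end
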